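(* Let $F$ be a field with $\operatorname{char}F\ne2$ and let $n\ge1$. For integers $l$ with $0\le2l\le n$ one has the index formulas $$|I(S(n,l,* ))|=2^{n-1}+2^{n-l-1}\quad(l\ge0),$$ $$|I(S(n,l,\tau_1))|=2^{n-1}\quad(l\ge0\text{ and }n>2l),$$ $$|I(S(n,l,\tau_2))|=2^{n-1}-2^{n-l-1}\quad(l\ge1).$$ In particular, for arbitrary $l_0,l_1\ge0$ and $l_2\ge1$ such that $n\ge2l_0$, $n\ge 2l_2$ and $n>2l_1$, $$|I(S(n,l_0,* ))|>|I(S(n,l_1,\tau_1))|>|I(S(n,l_2,\tau_2))|.$$
   Context: $\mathbf h_{l,n}=(h_{ij})$ is the $n\times n$ matrix with $l$ diagonal blocks $\begin{pmatrix}1&-1\\-1&1\end{pmatrix}$ occupying the first $2l$ rows and columns and all other entries $1$. The quantum torus $F_{\mathbf h_{l,n}}$ is the unital associative $F$-algebra with generators $t_1^{\pm1},\dots,t_n^{\pm1}$ and relations $t_it_i^{-1}=t_i^{-1}t_i=1$, $t_jt_i=h_{ij}t_it_j$. For $a_i=\pm1$, the involution of type $(a_1,\dots,a_n)$ is the unique involution ($F$-linear anti-automorphism of period at most $2$) with $t_i\mapsto a_it_i$ for all $i$. On $F_{\mathbf h_{l,n}}$: $*$ is the involution of type $(1,\dots,1)$; $\tau_1$ (defined when $n>2l$) has type with $-1$ only in position $2l+1$ and $1$ elsewhere; $\tau_2$ (defined when $l\ge1$) has type with $-1$ only in positions $2l-1$ and $2l$ and $1$ elsewhere. Let $\Lambda$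 be a free abelian group with basis $\boldsymbol\sigma_1,\dots,\boldsymbol\sigma_n$, and $t_{\boldsymbol\alpha}=t_1^{\alpha_1}\cdots t_n^{\alpha_n}$ for $\boldsymbol\alpha=\sum\alpha_i\boldsymbol\sigma_i$. For $\tau\in\{*,\tau_1,\tau_2\}$ put $S(n,l,\tau)=\{\boldsymbol\alpha\in\Lambda\mid\tau(t_{\boldsymbol\alpha})=t_{\boldsymbol\alpha}\}$ and $$I(S(n,l,\tau))=\{(\kappa_1,\dots,\kappa_n)\in\{0,1\}^n\mid\kappa_1\boldsymbol\sigma_1+\cdots+\kappa_n\boldsymbol\sigma_n\in S(n,l,\tau)\}=\{\kappa\in\{0,1\}^n\mid\tau(t_1^{\kappa_1}\cdots t_n^{\kappa_n})=t_1^{\kappa_1}\cdots t_n^{\kappa_n}\}.$$ *)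

theory Defs
  imports "HOL-Algebra.Module" "HOL-Algebra.QuotRing" "HOL-Algebra.Free_Abelian_Groups"
begin

text \<open>
  Words over an alphabet form the free monoid.  With this instance the type
  \<open>'x list \<Rightarrow>\<^sub>0 'f\<close> of finitely supported functions carries the convolution product
  of \<^theory>\<open>HOL-Library.Poly_Mapping\<close>, i.e. it is the free unital associative algebra.
\<close>

instantiation list :: (type) monoid_add
begin

definition zero_list :: "'a list" where "zero_list = []"
definition plus_list :: "'a list \<Rightarrow> 'a list \<Rightarrow> 'a list" where "plus_list u v = u @ v"

instance by standard (simp_all add: zero_list_def plus_list_def)

end


section \<open>Algebras over a field given by generators and relations\<close>

text \<open>
  An algebra is represented by a record of type \<open>module\<close>; the scalars are a type of
  class \<open>field\<close>.
\<close>

type_synonym ('x, 'f) free_elem = "'x list \<Rightarrow>\<^sub>0 'f"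

definition free_algebra :: "'x set \<Rightarrow> ('f::field, ('x, 'f) free_elem) module" where
  "free_algebra L =
    \<lparr>carrier = {p. Poly_Mapping.keys p \<subseteq> lists L},
     monoid.mult = (*), one = 1, ring.zero = 0, add = (+),
     smult = (\<lambda>c p. Poly_Mapping.single 0 c * p)\<rparr>"

definition free_gen :: "'x \<Rightarrow> ('x, 'f::field) free_elem" where
  "free_gen x = Poly_Mapping.single [x] 1"

text \<open>
  Quotient of an algebra by a two-sided ideal.  The scalar action on cosets is written in
  the same style as \<^const>\<open>rcoset_mult\<close>.
\<close>

definition quot_algebra :: "('f, 'a) module \<Rightarrow> 'a set \<Rightarrow> ('f, 'a set) module" where
  "quot_algebra A I =
    ring.extend (A Quot I)
      (module.fields (\<lambda>c U. \<Union>u\<in>U. I +>\<^bsub>A\<^esub> (c \<odot>\<^bsub>A\<^esub> u)))"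

definition presented_algebra ::
    "'x set \<Rightarrow> ('x, 'f::field) free_elem set \<Rightarrow> ('f, ('x, 'f) free_elem set) module" where
  "presented_algebra L R = quot_algebra (free_algebra L) (Idl\<^bsub>free_algebra L\<^esub> R)"

definition presented_gen ::
    "'x set \<Rightarrow> ('x, 'f::field) free_elem set \<Rightarrow> 'x \<Rightarrow> ('x, 'f) free_elem set" where
  "presented_gen L R x = (Idl\<^bsub>free_algebra L\<^esub> R) +>\<^bsub>free_algebra L\<^esub> free_gen x"


section \<open>Involutions\<close>

definition anti_automorphism :: "('f, 'a, 'm) module_scheme \<Rightarrow> ('a \<Rightarrow> 'a) \<Rightarrow> bool" where
  "anti_automorphism A \<phi> \<longleftrightarrow>
    bij_betw \<phi> (carrier A) (carrier A) \<and>
    (\<forall>x\<in>carrier A. \<forall>y\<in>carrier A. \<phi> (x \<oplus>\<^bsub>A\<^esub> y) = \<phi> x \<oplus>\<^bsub>A\<^esub> \<phi> y) \<and>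
    (\<forall>c. \<forall>x\<in>carrier A. \<phi> (c \<odot>\<^bsub>A\<^esub> x) = c \<odot>\<^bsub>A\<^esub> \<phi> x) \<and>
    (\<forall>x\<in>carrier A. \<forall>y\<in>carrier A. \<phi> (x \<otimes>\<^bsub>A\<^esub> y) = \<phi> y \<otimes>\<^bsub>A\<^esub> \<phi> x) \<and>
    \<phi> \<one>\<^bsub>A\<^esub> = \<one>\<^bsub>A\<^esub>"

definition involution :: "('f, 'a, 'm) module_scheme \<Rightarrow> ('a \<Rightarrow> 'a) \<Rightarrow> bool" where
  "involution A \<phi> \<longleftrightarrow> anti_automorphism A \<phi> \<and> (\<forall>x\<in>carrier A. \<phi> (\<phi> x) = x)"


section \<open>Quantum tori\<close>

text \<open>\<open>Pos i\<close> and \<open>Neg i\<close> stand for the generators $t_i$ and $t_i^{-1}$.\<close>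

datatype torus_letter = Pos nat | Neg nat

type_synonym 'f torus_elem = "(torus_letter, 'f) free_elem set"

definition torus_letters :: "nat \<Rightarrow> torus_letter set" where
  "torus_letters n = Pos ` {1..n} \<union> Neg ` {1..n}"

definition torus_rels ::
    "nat \<Rightarrow> (nat \<Rightarrow> nat \<Rightarrow> 'f::field) \<Rightarrow> (torus_letter, 'f) free_elem set" where
  "torus_rels n q =
    {free_gen (Pos i) * free_gen (Neg i) - 1 | i. i \<in> {1..n}} \<union>
    {free_gen (Neg i) * free_gen (Pos i) - 1 | i. i \<in> {1..n}} \<union>
    {free_gen (Pos j) * free_gen (Pos i)
       - Poly_Mapping.single 0 (q i j) * (free_gen (Pos i) * free_gen (Pos j)) | i j.
       i \<in> {1..n} \<and> j \<in> {1..n}}"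

definition quantum_torus ::
    "nat \<Rightarrow> (nat \<Rightarrow> nat \<Rightarrow> 'f::field) \<Rightarrow> ('f, 'f torus_elem) module" where
  "quantum_torus n q = presented_algebra (torus_letters n) (torus_rels n q)"

definition torus_gen :: "nat \<Rightarrow> (nat \<Rightarrow> nat \<Rightarrow> 'f::field) \<Rightarrow> nat \<Rightarrow> 'f torus_elem" where
  "torus_gen n q i = presented_gen (torus_letters n) (torus_rels n q) (Pos i)"

text \<open>
  The involution of type $(a_1,\dots,a_n)$.  Membership in \<^const>\<open>extensional\<close> only fixes
  the irrelevant values outside the carrier, so that the involution is unique as a HOL
  function.
\<close>

definition torus_involution ::
    "nat \<Rightarrow> (nat \<Rightarrow> nat \<Rightarrow> 'f::field) \<Rightarrow> (nat \<Rightarrow> 'f) \<Rightarrow> 'f torus_elem \<Rightarrow> 'f torus_elem" where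
  "torus_involution n q a =
    (THE \<phi>. \<phi> \<in> extensional (carrier (quantum_torus n q)) \<and>
            involution (quantum_torus n q) \<phi> \<and>
            (\<forall>i\<in>{1..n}. \<phi> (torus_gen n q i) = a i \<odot>\<^bsub>quantum_torus n q\<^esub> torus_gen n q i))"

text \<open>
  The lattice $\Lambda$ is \<^term>\<open>free_Abelian_group {1..n}\<close>, with basis vectors
  \<^term>\<open>frag_of i\<close>.  The factors of $t_{\alpha} = t_1^{\alpha_1}\cdots t_n^{\alpha_n}$ do not
  commute, so the product is taken along a list.
\<close>

definition torus_monom ::
    "nat \<Rightarrow> (nat \<Rightarrow> nat \<Rightarrow> 'f::field) \<Rightarrow> (nat \<Rightarrow>\<^sub>0 int) \<Rightarrow> 'f torus_elem" where
  "torus_monom n q \<alpha> =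
    foldr (\<otimes>\<^bsub>quantum_torus n q\<^esub>)
      (map (\<lambda>i. torus_gen n q i [^]\<^bsub>quantum_torus n q\<^esub> Poly_Mapping.lookup \<alpha> i) [1..<Suc n])
      \<one>\<^bsub>quantum_torus n q\<^esub>"


section \<open>The tori of the matrices $\mathbf{h}_{l,n}$\<close>

text \<open>
  Entries with 1-based indices; they do not depend on the size $n$.  The off-diagonal
  positions of the $k$-th diagonal block are $(2k-1, 2k)$ and $(2k, 2k-1)$.
\<close>

definition h_mat :: "nat \<Rightarrow> nat \<Rightarrow> nat \<Rightarrow> 'f::field" where
  "h_mat l i j = (if \<exists>k\<in>{1..l}. {i, j} = {2 * k - 1, 2 * k} then -1 else 1)"

definition inv_star :: "nat \<Rightarrow> nat \<Rightarrow> 'f::field torus_elem \<Rightarrow> 'f torus_elem" where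
  "inv_star n l = torus_involution n (h_mat l) (\<lambda>i. 1)"

text \<open>The next two are meaningful only for \<open>n > 2 * l\<close> and for \<open>l \<ge> 1\<close>, respectively.\<close>

definition inv_tau1 :: "nat \<Rightarrow> nat \<Rightarrow> 'f::field torus_elem \<Rightarrow> 'f torus_elem" where
  "inv_tau1 n l = torus_involution n (h_mat l) (\<lambda>i. if i = 2 * l + 1 then -1 else 1)"

definition inv_tau2 :: "nat \<Rightarrow> nat \<Rightarrow> 'f::field torus_elem \<Rightarrow> 'f torus_elem" where
  "inv_tau2 n l =
    torus_involution n (h_mat l) (\<lambda>i. if i = 2 * l - 1 \<or> i = 2 * l then -1 else 1)"

definition S_set ::
    "nat \<Rightarrow> nat \<Rightarrow> ('f::field torus_elem \<Rightarrow> 'f torus_elem) \<Rightarrow> (nat \<Rightarrow>\<^sub>0 int) set" where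
  "S_set n l \<tau> =
    {\<alpha> \<in> carrier (free_Abelian_group {1..n}).
       \<tau> (torus_monom n (h_mat l) \<alpha>) = torus_monom n (h_mat l) \<alpha>}"

definition I_set :: "nat \<Rightarrow> (nat \<Rightarrow>\<^sub>0 int) set \<Rightarrow> (nat \<Rightarrow> int) set" where
  "I_set n S = {\<kappa> \<in> {1..n} \<rightarrow>\<^sub>E {0, 1}. (\<Sum>i = 1..n. frag_cmul (\<kappa> i) (frag_of i)) \<in> S}"

end

theory Submission
  imports Defs
begin

text \<open>
  An anti-automorphism reverses products, so the involution of type $(a_1,\dots,a_n)$ sends
  $t_1^{\kappa_1}\cdots t_n^{\kappa_n}$ to
  $\prod_i a_i^{\kappa_i}\, t_n^{\kappa_n}\cdots t_1^{\kappa_1}$.  Sorting the factors back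
  commutes every pair once, and a pair contributes $-1$ exactly when it is a block
  $\{2k-1,2k\}$ with $k\le l$.  Hence the monomial is multiplied by the sign
  $$\varepsilon(\kappa)=\prod_i a_i^{\kappa_i}\prod_{k\le l}(-1)^{\kappa_{2k-1}\kappa_{2k}}.$$
  Since the characteristic is not $2$ and monomials of the torus are nonzero, $\kappa$ lies in the
  index set iff $\varepsilon(\kappa)=1$, and so twice the cardinality of that set is
  $2^n+\sum_\kappa\varepsilon(\kappa)$.  The sum of signs factors: an index outside the
  blocks contributes $1+a_i$, and a block contributes $1+a+a'-aa'$, where $a,a'$ are its two types.
  Ordinary indices thus give $2$ and ordinary blocks give $2$, while the exceptional index of
  $\tau_1$ gives $0$ and the exceptional block of $\tau_2$ gives $-2$.  The sum of signs is
  $2^{n-l}$, $0$ and $-2^{n-l}$ for $*$, $\tau_1$ and $\tau_2$.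

  For a torus given by generators and relations, three points behind this computation need an
  argument.  The involution exists because reversing words, weighted by the $a_i$, maps the
  ideal of relations into itself (\<open>reversal_ideal\<close>); it is unique because its value on
  $t_i^{-1}$ is forced by its value on $t_i$ (\<open>involution_determined\<close>).  Together these give
  its explicit form \<open>torus_involution_cls\<close>.  Monomials are nonzero, even with distinct
  multiples distinct, because the torus acts on a space of functions by invertible
  operators of Clifford type (\<open>h_torus_word_eq_iff\<close>).  The reordering of a reversed monomial is
  \<open>cls_reverse_word\<close>, the counting is \<open>card_I_set\<close>, and the factorization of the
  sum of signs is \<open>sign_sum_blocks\<close>.
\<close>


section \<open>The free algebra\<close>

definition lin_ext :: "('w \<Rightarrow> 'c::zero \<Rightarrow> 'b::comm_monoid_add) \<Rightarrow> ('w \<Rightarrow>\<^sub>0 'c) \<Rightarrow> 'b" where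
  "lin_ext g p = (\<Sum>w\<in>Poly_Mapping.keys p. g w (Poly_Mapping.lookup p w))"

lemma lin_ext_0 [simp]: "lin_ext g 0 = 0"
  by (simp add: lin_ext_def)

lemma lin_ext_single: "g w 0 = 0 \<Longrightarrow> lin_ext g (Poly_Mapping.single w c) = g w c"
  by (simp add: lin_ext_def)

lemma lin_ext_add:
  assumes "\<And>w. g w 0 = 0" and "\<And>w c d. g w (c + d) = g w c + g w d"
  shows "lin_ext g (p + q) = lin_ext g p + lin_ext g q"
  unfolding lin_ext_def by (rule setsum_keys_plus_distrib) (simp_all add: assms)

lemma poly_mapping_eq_sum_single:
  "p = (\<Sum>w\<in>Poly_Mapping.keys p. Poly_Mapping.single w (Poly_Mapping.lookup p w))"
  by (rule poly_mapping_eqI)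
    (simp add: lookup_sum lookup_single when_def in_keys_iff sum.delta)

lemma free_algebra_sel:
  "carrier (free_algebra L) = {p. Poly_Mapping.keys p \<subseteq> lists L}"
  "x \<otimes>\<^bsub>free_algebra L\<^esub> y = x * y"
  "x \<oplus>\<^bsub>free_algebra L\<^esub> y = x + y"
  "\<one>\<^bsub>free_algebra L\<^esub> = 1"
  "\<zero>\<^bsub>free_algebra L\<^esub> = 0"
  "c \<odot>\<^bsub>free_algebra L\<^esub> x = Poly_Mapping.single 0 c * x"
  by (simp_all add: free_algebra_def)

lemma single_in_free_algebra:
  "w \<in> lists L \<Longrightarrow> Poly_Mapping.single w c \<in> carrier (free_algebra L)"
  by (simp add: free_algebra_sel)

lemma scalar_in_free_algebra [simp]: "Poly_Mapping.single 0 c \<in> carrier (free_algebra L)"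
  by (simp add: free_algebra_sel zero_list_def)

lemma one_in_free_algebra [simp]: "1 \<in> carrier (free_algebra L)"
  by (simp add: free_algebra_sel zero_list_def)

lemma zero_in_free_algebra [simp]: "0 \<in> carrier (free_algebra L)"
  by (simp add: free_algebra_sel)

lemma add_in_free_algebra:
  "p \<in> carrier (free_algebra L) \<Longrightarrow> q \<in> carrier (free_algebra L)
    \<Longrightarrow> p + q \<in> carrier (free_algebra L)"
  using keys_add[of p q] by (auto simp: free_algebra_sel)

lemma diff_in_free_algebra:
  "p \<in> carrier (free_algebra L) \<Longrightarrow> q \<in> carrier (free_algebra L)
    \<Longrightarrow> p - q \<in> carrier (free_algebra L)"
  using keys_diff[of p q] by (auto simp: free_algebra_sel)

lemma mult_in_free_algebra:
  assumes "p \<in> carrier (free_algebra L)" and "q \<in> carrier (free_algebra L)"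
  shows "p * q \<in> carrier (free_algebra L)"
proof -
  have "Poly_Mapping.keys (p * q) \<subseteq> lists L"
  proof
    fix w assume "w \<in> Poly_Mapping.keys (p * q)"
    then obtain u v where "w = u @ v" "u \<in> Poly_Mapping.keys p" "v \<in> Poly_Mapping.keys q"
      using keys_mult[of p q] by (auto simp: plus_list_def)
    then show "w \<in> lists L"
      using assms by (auto simp: free_algebra_sel)
  qed
  then show ?thesis by (simp add: free_algebra_sel)
qed

text \<open>
  The free algebra is spanned by words, so a linear or bilinear identity only has to be checked
  on multiples of words.
\<close>

lemma free_algebra_induct [consumes 1, case_names single add]:
  assumes "p \<in> carrier (free_algebra L)"
    and single: "\<And>w c. w \<in> lists L \<Longrightarrow> P (Poly_Mapping.single w c)"
    and add: "\<And>p q. \<lbrakk>p \<in> carrier (free_algebra L); q \<in> carrier (free_algebra L); P p; P q\<rbrakk>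
      \<Longrightarrow> P (p + q)"
  shows "P p"
proof -
  let ?s = "\<lambda>W. \<Sum>w\<in>W. Poly_Mapping.single w (Poly_Mapping.lookup p w)"
  have "?s W \<in> carrier (free_algebra L) \<and> P (?s W)" if "finite W" "W \<subseteq> lists L" for W
    using that
  proof (induction W rule: finite_induct)
    case empty
    have "P (Poly_Mapping.single [] 0)" by (rule single) simp
    then show ?case by simp
  next
    case (insert w W)
    then show ?case by (simp add: add add_in_free_algebra single single_in_free_algebra)
  qed
  from this[of "Poly_Mapping.keys p"] show ?thesis
    using assms(1) by (simp add: free_algebra_sel flip: poly_mapping_eq_sum_single)
qed

lemma ring_free_algebra: "ring (free_algebra L)"
proof (rule ringI)
  show "abelian_group (free_algebra L)"
  proof (rule abelian_groupI)
    fix p assume p: "p \<in> carrier (free_algebra L)"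
    show "\<exists>q\<in>carrier (free_algebra L). q \<oplus>\<^bsub>free_algebra L\<^esub> p = \<zero>\<^bsub>free_algebra L\<^esub>"
      using p by (intro bexI[of _ "- p"]) (auto simp: free_algebra_sel)
  qed (auto simp: free_algebra_sel(3,5) add_in_free_algebra add.assoc add.commute)
  show "Group.monoid (free_algebra L)"
    by (rule monoidI) (auto simp: free_algebra_sel(2,4) mult_in_free_algebra mult.assoc)
qed (simp_all add: free_algebra_sel(2,3) distrib_left distrib_right)

text \<open>
  Closure under negation comes for free, since $-p$ is the product of the scalar $-1$ with $p$.
\<close>

lemma ideal_free_algebraI:
  assumes "J \<subseteq> carrier (free_algebra L)" and "0 \<in> J"
    and add: "\<And>p q. p \<in> J \<Longrightarrow> q \<in> J \<Longrightarrow> p + q \<in> J"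
    and left: "\<And>p u. p \<in> J \<Longrightarrow> u \<in> carrier (free_algebra L) \<Longrightarrow> u * p \<in> J"
    and right: "\<And>p u. p \<in> J \<Longrightarrow> u \<in> carrier (free_algebra L) \<Longrightarrow> p * u \<in> J"
  shows "ideal J (free_algebra L)"
proof (rule idealI[OF ring_free_algebra])
  interpret ring "free_algebra L" by (rule ring_free_algebra)
  show "subgroup J (add_monoid (free_algebra L))"
  proof (rule group.subgroupI)
    show "inv\<^bsub>add_monoid (free_algebra L)\<^esub> p \<in> J" if p: "p \<in> J" for p
    proof -
      have pC: "p \<in> carrier (free_algebra L)" using p assms(1) by blast
      have m: "- p = Poly_Mapping.single 0 (-1) * p"
        by (simp add: single_uminus)
      have "inv\<^bsub>add_monoid (free_algebra L)\<^esub> p = - p"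
        using pC diff_in_free_algebra[of 0 L p]
        by (intro group.inv_equality[OF a_group]) (simp_all add: free_algebra_sel(3,5))
      then show ?thesis
        using left[OF p, of "Poly_Mapping.single 0 (-1)"] m by simp
    qed
  qed (use assms a_group in \<open>auto simp: free_algebra_sel(3)\<close>)
qed (simp_all add: free_algebra_sel(2) left right)


section \<open>Computing in a presented algebra\<close>

text \<open>
  Every element of the presented algebra is the coset \<open>cls p\<close> of an element \<open>p\<close> of the free
  algebra, and the operations can be carried out on representatives.
\<close>

locale presentation =
  fixes L :: "'x set" and R :: "('x, 'f::field) free_elem set"
  assumes relators: "R \<subseteq> carrier (free_algebra L)"
begin

abbreviation relator_ideal where "relator_ideal \<equiv> Idl\<^bsub>free_algebra L\<^esub> R"
abbreviation cls where "cls p \<equiv> relator_ideal +>\<^bsub>free_algebra L\<^esub> p"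
abbreviation Q where "Q \<equiv> presented_algebra L R"

lemma ideal_relators: "ideal relator_ideal (free_algebra L)"
  by (rule ring.genideal_ideal[OF ring_free_algebra relators])

lemma mult_ideal:
  assumes "p \<in> relator_ideal" and "u \<in> carrier (free_algebra L)"
  shows "u * p \<in> relator_ideal" and "p * u \<in> relator_ideal"
  using ideal.I_l_closed[OF ideal_relators assms] ideal.I_r_closed[OF ideal_relators assms]
  by (simp_all add: free_algebra_sel(2))

lemma zero_ideal: "0 \<in> relator_ideal"
  using additive_subgroup.zero_closed[OF ideal.axioms(1)[OF ideal_relators]]
  by (simp add: free_algebra_sel(5))

lemma add_ideal: "p \<in> relator_ideal \<Longrightarrow> q \<in> relator_ideal \<Longrightarrow> p + q \<in> relator_ideal"
  using additive_subgroup.a_closed[OF ideal.axioms(1)[OF ideal_relators], of p q]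
  by (simp add: free_algebra_sel(3))

lemma uminus_ideal: "p \<in> relator_ideal \<Longrightarrow> - p \<in> relator_ideal"
  using mult_ideal(1)[of p "Poly_Mapping.single 0 (-1)"] scalar_in_free_algebra[of "-1::'f" L]
  by (simp add: single_uminus)

lemma relator_ideal_minimal:
  assumes "R \<subseteq> J" and "ideal J (free_algebra L)"
  shows "relator_ideal \<subseteq> J"
  using ring.genideal_minimal[OF ring_free_algebra assms(2,1)] .

lemma cls_Collect: "cls p = {h + p | h. h \<in> relator_ideal}"
  by (auto simp: a_r_coset_def' free_algebra_sel(3))

lemma cls_eq_iff: "cls p = cls q \<longleftrightarrow> p - q \<in> relator_ideal"
proof
  assume "cls p = cls q"
  then have "0 + p \<in> cls q" using zero_ideal unfolding cls_Collect by blast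
  then show "p - q \<in> relator_ideal" unfolding cls_Collect by force
next
  have sub: "cls p \<subseteq> cls q" if "p - q \<in> relator_ideal" for p q
  proof
    fix x assume "x \<in> cls p"
    then obtain h where h: "h \<in> relator_ideal" and x: "x = h + p" unfolding cls_Collect by blast
    have "h + (p - q) \<in> relator_ideal" using h that by (rule add_ideal)
    moreover have "x = (h + (p - q)) + q" unfolding x by simp
    ultimately show "x \<in> cls q" unfolding cls_Collect by blast
  qed
  assume d: "p - q \<in> relator_ideal"
  have "q - p \<in> relator_ideal" using uminus_ideal[OF d] by simp
  show "cls p = cls q" by (rule equalityI) (rule sub, fact)+
qed

lemma Q_sel:
  "carrier Q = cls ` carrier (free_algebra L)"
  "\<one>\<^bsub>Q\<^esub> = cls 1"
  by (auto simp: presented_algebra_def quot_algebra_def ring.defs FactRing_def A_RCOSETS_def'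
        free_algebra_sel(4))

lemma ideal_abelian_subgroup: "abelian_subgroup relator_ideal (free_algebra L)"
  using ideal.axioms(1)[OF ideal_relators] ring.is_abelian_group[OF ring_free_algebra]
  by (rule abelian_subgroupI3)

lemma Q_ops:
  assumes "p \<in> carrier (free_algebra L)" and "q \<in> carrier (free_algebra L)"
  shows "cls p \<oplus>\<^bsub>Q\<^esub> cls q = cls (p + q)"
    and "cls p \<otimes>\<^bsub>Q\<^esub> cls q = cls (p * q)"
  using abelian_subgroup.a_rcos_sum[OF ideal_abelian_subgroup assms]
    ideal.rcoset_mult_add[OF ideal_relators assms]
  by (simp_all add: presented_algebra_def quot_algebra_def ring.defs FactRing_def
        free_algebra_sel)

text \<open>
  The scalar action on a coset is a union over all of its members; it is a single coset because
  the ideal of relations is closed under multiplication by scalars.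
\<close>

lemma Q_smult:
  assumes p: "p \<in> carrier (free_algebra L)"
  shows "c \<odot>\<^bsub>Q\<^esub> cls p = cls (Poly_Mapping.single 0 c * p)"
proof -
  have "cls (Poly_Mapping.single 0 c * u) = cls (Poly_Mapping.single 0 c * p)" if "u \<in> cls p" for u
  proof -
    have "u - p \<in> relator_ideal"
      using that unfolding cls_Collect by force
    then have "Poly_Mapping.single 0 c * (u - p) \<in> relator_ideal"
      by (rule mult_ideal) (rule scalar_in_free_algebra)
    then show ?thesis
      by (simp only: cls_eq_iff right_diff_distrib)
  qed
  moreover have "p \<in> cls p" using zero_ideal unfolding cls_Collect
    by (auto intro!: exI[of _ 0])
  ultimately have "(\<Union>u\<in>cls p. cls (Poly_Mapping.single 0 c * u))
      = cls (Poly_Mapping.single 0 c * p)"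
    by blast
  then show ?thesis
    by (simp add: presented_algebra_def quot_algebra_def ring.defs module.defs
        free_algebra_sel(6))
qed

text \<open>
  Allows the relations of the algebra to be applied inside a product of words.
\<close>

lemma cls_mult_cong:
  assumes "cls p = cls p'" and "cls q = cls q'"
    and "p' \<in> carrier (free_algebra L)" and "q \<in> carrier (free_algebra L)"
  shows "cls (p * q) = cls (p' * q')"
proof -
  have "(p - p') * q + p' * (q - q') \<in> relator_ideal"
    using assms by (intro add_ideal mult_ideal(2)[of "p - p'"] mult_ideal(1)[of "q - q'"])
      (simp_all add: cls_eq_iff)
  then show ?thesis by (simp add: cls_eq_iff algebra_simps)
qed

end


section \<open>Reversal of words\<close>

primrec letter_index :: "torus_letter \<Rightarrow> nat" where
  "letter_index (Pos i) = i"
| "letter_index (Neg i) = i"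

abbreviation word_type :: "(nat \<Rightarrow> 'f::field) \<Rightarrow> torus_letter list \<Rightarrow> 'f" where
  "word_type a w \<equiv> (\<Prod>x\<leftarrow>w. a (letter_index x))"

text \<open>
  The lift of the involution of type \<open>a\<close> to the free algebra.  A letter and its inverse get the
  same factor, which is the right one as soon as \<open>a i = 1\<close> or \<open>a i = -1\<close>.
\<close>

definition reversal ::
    "(nat \<Rightarrow> 'f::field) \<Rightarrow> (torus_letter, 'f) free_elem \<Rightarrow> (torus_letter, 'f) free_elem"
  where "reversal a = lin_ext (\<lambda>w c. Poly_Mapping.single (rev w) (word_type a w * c))"

lemma reversal_single:
  "reversal a (Poly_Mapping.single w c) = Poly_Mapping.single (rev w) (word_type a w * c)"
  by (simp add: reversal_def lin_ext_single)

lemma reversal_add: "reversal a (p + q) = reversal a p + reversal a q"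
  unfolding reversal_def by (rule lin_ext_add) (simp_all add: distrib_left single_add)

lemma reversal_diff: "reversal a (p - q) = reversal a p - reversal a q"
  using reversal_add[of a "p - q" q] by simp

lemma one_eq_single_Nil: "1 = Poly_Mapping.single [] 1"
  unfolding single_one[symmetric] zero_list_def ..

lemma reversal_one: "reversal a 1 = 1"
  unfolding one_eq_single_Nil by (simp add: reversal_single)

lemma reversal_mult: "reversal a (p * q) = reversal a q * reversal a p"
proof -
  have all: "p \<in> carrier (free_algebra UNIV)" for p :: "(torus_letter, 'f::field) free_elem"
    by (simp add: free_algebra_sel)
  show ?thesis
    using all[of p]
  proof (induction p rule: free_algebra_induct)
    case (single w c)
    show ?case
      using all[of q]
      by (induction q rule: free_algebra_induct)
        (simp_all add: reversal_single mult_single plus_list_def mult_ac reversal_add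
          distrib_left distrib_right)
  qed (simp add: reversal_add distrib_left distrib_right)
qed

lemma reversal_scalar:
  "reversal a (Poly_Mapping.single 0 c * p) = Poly_Mapping.single 0 c * reversal a p"
proof -
  have "p \<in> carrier (free_algebra UNIV)" by (simp add: free_algebra_sel)
  then show ?thesis
    by (induction p rule: free_algebra_induct)
      (simp_all add: reversal_single mult_single reversal_add distrib_left mult_ac)
qed

lemma reversal_in_free_algebra:
  "p \<in> carrier (free_algebra L) \<Longrightarrow> reversal a p \<in> carrier (free_algebra L)"
  by (induction p rule: free_algebra_induct)
    (auto simp: reversal_single reversal_add intro!: single_in_free_algebra add_in_free_algebra)

lemma reversal_reversal:
  assumes "p \<in> carrier (free_algebra L)"
    and sq: "\<And>x. x \<in> L \<Longrightarrow> a (letter_index x) * a (letter_index x) = 1"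
  shows "reversal a (reversal a p) = p"
  using assms(1)
proof (induction p rule: free_algebra_induct)
  case (single w c)
  have "word_type a w * word_type a w = 1"
    using single
  proof (induction w)
    case (Cons x w)
    then have "a (letter_index x) * a (letter_index x) * (word_type a w * word_type a w) = 1"
      by (simp add: sq)
    then show ?case by (simp only: list.map prod_list.Cons mult_ac)
  qed simp
  moreover have "word_type a (rev w) = word_type a w"
    by (simp flip: rev_map)
  ultimately show ?case
    by (simp add: reversal_single flip: mult.assoc)
qed (simp add: reversal_add)

text \<open>
  The factor that the involution of type \<open>a\<close> produces on the monomial with index list \<open>xs\<close> in the
  torus of \<open>q\<close>: one entry of \<open>a\<close> per index, one entry of \<open>q\<close> per pair of positions.
\<close>

primrec reversal_factor :: "(nat \<Rightarrow> 'a::comm_ring_1) \<Rightarrow> (nat \<Rightarrow> nat \<Rightarrow> 'a) \<Rightarrow> nat list \<Rightarrow> 'a" where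
  "reversal_factor a q [] = 1"
| "reversal_factor a q (x # xs) = a x * (\<Prod>y\<leftarrow>xs. q x y) * reversal_factor a q xs"


section \<open>Involutions of quantum tori\<close>

text \<open>
  Symmetry of \<open>q\<close> makes the set of commutation relations stable under reversal of words: the
  reversed relation for \<open>(i, j)\<close> is the relation for \<open>(j, i)\<close>.
\<close>

locale symmetric_torus =
  fixes n :: nat and q :: "nat \<Rightarrow> nat \<Rightarrow> 'f::field"
  assumes q_sym: "q i j = q j i"
begin

abbreviation C where "C \<equiv> carrier (free_algebra (torus_letters n)) :: (torus_letter, 'f) free_elem set"

lemma Pos_letter [simp]: "Pos i \<in> torus_letters n \<longleftrightarrow> i \<in> {1..n}"
  and Neg_letter [simp]: "Neg i \<in> torus_letters n \<longleftrightarrow> i \<in> {1..n}"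
  by (auto simp: torus_letters_def)

lemma torus_rels_eq:
  "torus_rels n q =
    {Poly_Mapping.single [Pos i, Neg i] 1 - 1 | i. i \<in> {1..n}} \<union>
    {Poly_Mapping.single [Neg i, Pos i] 1 - 1 | i. i \<in> {1..n}} \<union>
    {Poly_Mapping.single [Pos j, Pos i] 1 - Poly_Mapping.single [Pos i, Pos j] (q i j) | i j.
      i \<in> {1..n} \<and> j \<in> {1..n}}"
  by (simp add: torus_rels_def free_gen_def mult_single plus_list_def zero_list_def)

lemma torus_rels_in_free_algebra: "torus_rels n q \<subseteq> C"
  unfolding torus_rels_eq
  by (auto intro!: diff_in_free_algebra single_in_free_algebra)

sublocale presentation "torus_letters n" "torus_rels n q"
  by unfold_locales (rule torus_rels_in_free_algebra)

lemma relator_in_ideal: "p \<in> torus_rels n q \<Longrightarrow> p \<in> relator_ideal"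
  by (rule subsetD[OF ring.genideal_self[OF ring_free_algebra torus_rels_in_free_algebra]])

lemma relators_in_ideal:
  assumes "i \<in> {1..n}"
  shows "Poly_Mapping.single [Pos i, Neg i] 1 - 1 \<in> relator_ideal"
    and "Poly_Mapping.single [Neg i, Pos i] 1 - 1 \<in> relator_ideal"
    and "j \<in> {1..n} \<Longrightarrow> Poly_Mapping.single [Pos j, Pos i] 1
      - Poly_Mapping.single [Pos i, Pos j] (q i j) \<in> relator_ideal"
proof -
  show "Poly_Mapping.single [Pos i, Neg i] 1 - 1 \<in> relator_ideal"
    by (rule relator_in_ideal, unfold torus_rels_eq) (use assms in blast)
  show "Poly_Mapping.single [Neg i, Pos i] 1 - 1 \<in> relator_ideal"
    by (rule relator_in_ideal, unfold torus_rels_eq) (use assms in blast)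
  show "Poly_Mapping.single [Pos j, Pos i] 1
      - Poly_Mapping.single [Pos i, Pos j] (q i j) \<in> relator_ideal" if "j \<in> {1..n}"
    by (rule relator_in_ideal, unfold torus_rels_eq) (use assms that in blast)
qed

lemma quantum_torus_eq: "quantum_torus n q = Q"
  by (simp add: quantum_torus_def)

lemma torus_gen_eq: "torus_gen n q i = cls (Poly_Mapping.single [Pos i] 1)"
  by (simp add: torus_gen_def presented_gen_def free_gen_def)

lemma cls_Pos_Neg: "i \<in> {1..n} \<Longrightarrow> cls (Poly_Mapping.single [Pos i, Neg i] 1) = cls 1"
  unfolding cls_eq_iff by (rule relators_in_ideal)

lemma cls_commute:
  assumes "i \<in> {1..n}" "j \<in> {1..n}"
  shows "cls (Poly_Mapping.single [Pos j, Pos i] 1) = cls (Poly_Mapping.single [Pos i, Pos j] (q i j))"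
  unfolding cls_eq_iff using assms by (rule relators_in_ideal)

text \<open>
  The elements sent into the ideal of relations form an ideal themselves, so it is enough to look at
  the relations.  The relations for $t_i$ and $t_i^{-1}$ are exchanged, and a commutation
  relation goes to a multiple of a commutation relation.
\<close>

lemma reversal_ideal:
  fixes a :: "nat \<Rightarrow> 'f"
  assumes sq: "\<And>i. i \<in> {1..n} \<Longrightarrow> a i * a i = 1" and p: "p \<in> relator_ideal"
  shows "reversal a p \<in> relator_ideal"
proof -
  let ?J = "{p \<in> C. reversal a p \<in> relator_ideal}"
  have "reversal a r \<in> relator_ideal" if r: "r \<in> torus_rels n q" for r
    using r[unfolded torus_rels_eq]
  proof (elim UnE)
    assume "r \<in> {Poly_Mapping.single [Pos i, Neg i] 1 - 1 | i. i \<in> {1..n}}"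
    then obtain i where i: "i \<in> {1..n}" and "r = Poly_Mapping.single [Pos i, Neg i] 1 - 1"
      by blast
    then have "reversal a r = Poly_Mapping.single [Neg i, Pos i] 1 - 1"
      by (simp add: reversal_diff reversal_single reversal_one sq)
    then show ?thesis using relators_in_ideal[OF i] by simp
  next
    assume "r \<in> {Poly_Mapping.single [Neg i, Pos i] 1 - 1 | i. i \<in> {1..n}}"
    then obtain i where i: "i \<in> {1..n}" and "r = Poly_Mapping.single [Neg i, Pos i] 1 - 1"
      by blast
    then have "reversal a r = Poly_Mapping.single [Pos i, Neg i] 1 - 1"
      by (simp add: reversal_diff reversal_single reversal_one sq)
    then show ?thesis using relators_in_ideal[OF i] by simp
  next
    assume "r \<in> {Poly_Mapping.single [Pos j, Pos i] 1 - Poly_Mapping.single [Pos i, Pos j] (q i j) | i j.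
      i \<in> {1..n} \<and> j \<in> {1..n}}"
    then obtain i j where ij: "i \<in> {1..n}" "j \<in> {1..n}"
      and r: "r = Poly_Mapping.single [Pos j, Pos i] 1 - Poly_Mapping.single [Pos i, Pos j] (q i j)"
      by blast
    let ?r = "Poly_Mapping.single [Pos i, Pos j] 1 - Poly_Mapping.single [Pos j, Pos i] (q j i)"
    have "reversal a r = Poly_Mapping.single 0 (a i * a j) * ?r"
      by (simp add: r reversal_diff reversal_single right_diff_distrib mult_single q_sym[of i j]
          mult_ac)
    moreover have "?r \<in> relator_ideal"
      using ij by (simp only: relators_in_ideal)
    ultimately show ?thesis by (simp add: mult_ideal)
  qed
  then have "torus_rels n q \<subseteq> ?J"
    using torus_rels_in_free_algebra by blast
  moreover have "ideal ?J (free_algebra (torus_letters n))"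
  proof (rule ideal_free_algebraI)
    have "0 = reversal a 0" by (simp add: reversal_def)
    then show "0 \<in> ?J"
      using zero_ideal by simp
  qed (auto simp: reversal_add reversal_mult add_ideal mult_ideal add_in_free_algebra
      mult_in_free_algebra reversal_in_free_algebra)
  ultimately have "relator_ideal \<subseteq> ?J" by (rule relator_ideal_minimal)
  from subsetD[OF this p] show ?thesis by simp
qed

lemma monoid_Q: "Group.monoid Q"
  by (rule monoidI) (auto simp: Q_sel Q_ops mult_in_free_algebra mult.assoc)

text \<open>
  An anti-automorphism is determined by its values on letters.  For the letter $t_i^{-1}$,
  its image is a left inverse of $a_it_i$, and $a_it_i^{-1}$ is a right inverse because
  $a_i^2=1$, so the two agree.
\<close>

lemma involution_determined:
  fixes a :: "nat \<Rightarrow> 'f"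
  assumes sq: "\<And>i. i \<in> {1..n} \<Longrightarrow> a i * a i = 1"
    and inv: "involution Q \<phi>"
    and gen: "\<And>i. i \<in> {1..n} \<Longrightarrow> \<phi> (torus_gen n q i) = a i \<odot>\<^bsub>Q\<^esub> torus_gen n q i"
    and p: "p \<in> C"
  shows "\<phi> (cls p) = cls (reversal a p)"
proof -
  interpret Qm: Group.monoid Q by (rule monoid_Q)
  have bij: "bij_betw \<phi> (carrier Q) (carrier Q)"
    and add_hom: "\<And>p r. p \<in> C \<Longrightarrow> r \<in> C \<Longrightarrow> \<phi> (cls (p + r)) = \<phi> (cls p) \<oplus>\<^bsub>Q\<^esub> \<phi> (cls r)"
    and smult_Q: "\<And>c U. U \<in> carrier Q \<Longrightarrow> \<phi> (c \<odot>\<^bsub>Q\<^esub> U) = c \<odot>\<^bsub>Q\<^esub> \<phi> U"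
    and mult: "\<And>p r. p \<in> C \<Longrightarrow> r \<in> C \<Longrightarrow> \<phi> (cls (p * r)) = \<phi> (cls r) \<otimes>\<^bsub>Q\<^esub> \<phi> (cls p)"
    and one: "\<phi> (cls 1) = cls 1"
    using inv unfolding involution_def anti_automorphism_def Q_sel
    by (auto simp flip: Q_ops)
  have smult: "\<phi> (cls (Poly_Mapping.single 0 c * p)) = c \<odot>\<^bsub>Q\<^esub> \<phi> (cls p)" if "p \<in> C" for c p
    using smult_Q[of "cls p" c] that by (simp add: Q_smult Q_sel)
  have Pos: "\<phi> (cls (Poly_Mapping.single [Pos i] 1)) = cls (Poly_Mapping.single [Pos i] (a i))"
    if "i \<in> {1..n}" for i
    using gen[OF that] that
    by (simp add: torus_gen_eq Q_smult single_in_free_algebra mult_single)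
  have Neg: "\<phi> (cls (Poly_Mapping.single [Neg i] 1)) = cls (Poly_Mapping.single [Neg i] (a i))"
    if i: "i \<in> {1..n}" for i
  proof -
    let ?t = "cls (Poly_Mapping.single [Pos i] (a i))"
    let ?s = "cls (Poly_Mapping.single [Neg i] (a i))"
    let ?y = "\<phi> (cls (Poly_Mapping.single [Neg i] 1))"
    have t: "Poly_Mapping.single [Pos i] c \<in> C" and s: "Poly_Mapping.single [Neg i] c \<in> C" for c
      using i by (simp_all add: single_in_free_algebra)
    have y: "?y \<in> carrier Q"
      using bij_betwE[OF bij] s by (simp add: Q_sel(1))
    \<comment> \<open>the image of $t_it_i^{-1}=1$ under the anti-automorphism\<close>
    have yt: "?y \<otimes>\<^bsub>Q\<^esub> ?t = \<one>\<^bsub>Q\<^esub>"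
      using mult[OF t[of 1] s[of 1]] cls_Pos_Neg[OF i] one Pos[OF i]
      by (simp add: mult_single plus_list_def Q_sel)
    have ts: "?t \<otimes>\<^bsub>Q\<^esub> ?s = \<one>\<^bsub>Q\<^esub>"
      using cls_Pos_Neg[OF i] sq[OF i]
      by (simp add: Q_ops t s mult_single plus_list_def Q_sel)
    have tQ: "?t \<in> carrier Q" "?s \<in> carrier Q" using t s by (auto simp: Q_sel)
    have "?y = ?y \<otimes>\<^bsub>Q\<^esub> (?t \<otimes>\<^bsub>Q\<^esub> ?s)" using y ts by simp
    also have "\<dots> = ?s" using y tQ yt by (simp flip: Qm.m_assoc)
    finally show ?thesis .
  qed
  have letter: "\<phi> (cls (Poly_Mapping.single [x] 1))
      = cls (Poly_Mapping.single [x] (a (letter_index x)))" if "x \<in> torus_letters n" for x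
    using that Pos Neg by (auto simp: torus_letters_def)
  have word: "\<phi> (cls (Poly_Mapping.single w 1)) = cls (reversal a (Poly_Mapping.single w 1))"
    if "w \<in> lists (torus_letters n)" for w
    using that
  proof (induction w)
    case Nil
    show ?case using one by (simp add: reversal_single one_eq_single_Nil)
  next
    case (Cons x w)
    have "\<phi> (cls (Poly_Mapping.single (x # w) 1))
        = \<phi> (cls (Poly_Mapping.single w 1)) \<otimes>\<^bsub>Q\<^esub> \<phi> (cls (Poly_Mapping.single [x] 1))"
      using mult[of "Poly_Mapping.single [x] 1" "Poly_Mapping.single w 1"] Cons.hyps
      by (simp add: single_in_free_algebra mult_single plus_list_def)
    also have "\<dots> = cls (reversal a (Poly_Mapping.single (x # w) 1))"
      unfolding Cons.IH letter[OF Cons.hyps(1)]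
      using Cons.hyps
      by (subst Q_ops) (auto simp: reversal_single mult_single plus_list_def mult_ac
          intro!: single_in_free_algebra)
    finally show ?case .
  qed
  show ?thesis
    using p
  proof (induction p rule: free_algebra_induct)
    case (single w c)
    have e: "Poly_Mapping.single w c = Poly_Mapping.single 0 c * Poly_Mapping.single w 1"
      by (simp add: mult_single)
    show ?case
      unfolding e reversal_scalar
      by (simp add: single_in_free_algebra single smult word Q_smult reversal_in_free_algebra)
  next
    case (add p r)
    then show ?case
      by (simp add: add_hom Q_ops reversal_in_free_algebra reversal_add)
  qed
qed

text \<open>
  Reversal descends to the torus by \<open>reversal_ideal\<close> and is the only candidate by
  \<open>involution_determined\<close>, so the definite description of the involution denotes it.
\<close>

lemma torus_involution_cls:
  fixes a :: "nat \<Rightarrow> 'f"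
  assumes sq: "\<And>i. i \<in> {1..n} \<Longrightarrow> a i * a i = 1" and p: "p \<in> C"
  shows "torus_involution n q a (cls p) = cls (reversal a p)"
proof -
  \<comment> \<open>the map induced on cosets; by \<open>reversal_ideal\<close> the chosen representative is irrelevant\<close>
  define \<psi> where "\<psi> = restrict (\<lambda>U. cls (reversal a (SOME p. p \<in> C \<and> cls p = U))) (carrier Q)"
  have psi: "\<psi> (cls p) = cls (reversal a p)" if p: "p \<in> C" for p
  proof -
    define r where "r = (SOME r. r \<in> C \<and> cls r = cls p)"
    have "r \<in> C \<and> cls r = cls p"
      unfolding r_def by (rule someI[of _ p]) (simp add: p)
    then have "reversal a (r - p) \<in> relator_ideal"
      by (intro reversal_ideal sq) (auto simp: cls_eq_iff)
    then have "cls (reversal a r) = cls (reversal a p)"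
      by (simp add: cls_eq_iff reversal_diff)
    then show ?thesis using p by (simp add: \<psi>_def r_def Q_sel)
  qed
  have invol: "\<psi> (\<psi> U) = U" "\<psi> U \<in> carrier Q" if "U \<in> carrier Q" for U
  proof -
    obtain p where "p \<in> C" "U = cls p" using \<open>U \<in> carrier Q\<close> by (auto simp: Q_sel)
    moreover have "reversal a (reversal a p) = p"
      using \<open>p \<in> C\<close> by (rule reversal_reversal) (auto simp: torus_letters_def sq)
    ultimately show "\<psi> (\<psi> U) = U" "\<psi> U \<in> carrier Q"
      by (auto simp: psi reversal_in_free_algebra Q_sel)
  qed
  have "involution Q \<psi>"
    unfolding involution_def anti_automorphism_def
  proof (intro conjI ballI allI)
    show "bij_betw \<psi> (carrier Q) (carrier Q)"
      by (rule bij_betw_byWitness[where f' = \<psi>]) (auto simp: invol)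
    show "\<psi> (c \<odot>\<^bsub>Q\<^esub> U) = c \<odot>\<^bsub>Q\<^esub> \<psi> U" if "U \<in> carrier Q" for c U
    proof -
      from that obtain p where "p \<in> C" "U = cls p" by (auto simp: Q_sel)
      then show ?thesis
        by (simp add: Q_smult psi reversal_in_free_algebra mult_in_free_algebra reversal_scalar)
    qed
  qed (auto simp: invol Q_sel(1) Q_ops psi reversal_in_free_algebra add_in_free_algebra
      mult_in_free_algebra reversal_add reversal_mult Q_sel(2) reversal_one)
  moreover have "\<psi> \<in> extensional (carrier Q)" by (simp add: \<psi>_def)
  moreover have "\<psi> (torus_gen n q i) = a i \<odot>\<^bsub>Q\<^esub> torus_gen n q i" if "i \<in> {1..n}" for i
    using that
    by (simp add: torus_gen_eq psi Q_smult single_in_free_algebra reversal_single mult_single)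
  ultimately have "torus_involution n q a = \<psi>"
    unfolding torus_involution_def quantum_torus_eq
  proof (intro the_equality conjI ballI)
    fix \<phi>
    assume phi: "\<phi> \<in> extensional (carrier Q) \<and> involution Q \<phi> \<and>
      (\<forall>i\<in>{1..n}. \<phi> (torus_gen n q i) = a i \<odot>\<^bsub>Q\<^esub> torus_gen n q i)"
    show "\<phi> = \<psi>"
    proof (rule extensionalityI[of _ "carrier Q"])
      fix U assume "U \<in> carrier Q"
      then obtain p where "p \<in> C" "U = cls p" by (auto simp: Q_sel)
      then show "\<phi> U = \<psi> U"
        using involution_determined[of a \<phi> p, OF sq] phi by (simp add: psi)
    qed (use phi in \<open>simp_all add: \<psi>_def\<close>)
  qed auto
  then show ?thesis using p by (simp add: psi)
qed


section \<open>The involution on squarefree monomials\<close>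

text \<open>
  With exponents $0$ and $1$ the ordered product is the coset of one word, without inverse letters.
\<close>

lemma torus_monom_squarefree:
  assumes "\<And>i. i \<in> {1..n} \<Longrightarrow> \<kappa> i \<in> {0, 1}"
  shows "torus_monom n q (\<Sum>i = 1..n. frag_cmul (\<kappa> i) (frag_of i))
    = cls (Poly_Mapping.single (map Pos (filter (\<lambda>i. \<kappa> i = 1) [1..<Suc n])) 1)"
proof -
  interpret Qm: Group.monoid Q by (rule monoid_Q)
  let ?\<alpha> = "\<Sum>i = 1..n. frag_cmul (\<kappa> i) (frag_of i)"
  have coeff: "Poly_Mapping.lookup ?\<alpha> i = \<kappa> i" if "i \<in> {1..n}" for i
  proof -
    have "Poly_Mapping.lookup ?\<alpha> i = (\<Sum>j = 1..n. if j = i then \<kappa> j else 0)"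
      unfolding lookup_sum by (rule sum.cong) (auto simp: lookup_single when_def)
    then show ?thesis using that by (simp add: sum.delta)
  qed
  have pow: "U [^]\<^bsub>Q\<^esub> c = (if c = 1 then U else \<one>\<^bsub>Q\<^esub>)"
    if "U \<in> carrier Q" "c \<in> {0, 1}" for U and c :: int
    using that(2)
  proof
    assume "c \<in> {1}"
    then have "c = int (Suc 0)" by simp
    then show ?thesis using that(1) by (simp only: int_pow_int) simp
  next
    assume "c = 0"
    then have "c = int 0" by simp
    then show ?thesis by (simp only: int_pow_int) simp
  qed
  define t where "t i = torus_gen n q i [^]\<^bsub>Q\<^esub> Poly_Mapping.lookup ?\<alpha> i" for i
  have t: "t i = (if \<kappa> i = 1 then cls (Poly_Mapping.single [Pos i] 1) else \<one>\<^bsub>Q\<^esub>)"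
    if "i \<in> {1..n}" for i
  proof -
    have "cls (Poly_Mapping.single [Pos i] 1) \<in> carrier Q"
      unfolding Q_sel using that by (intro imageI single_in_free_algebra) simp
    from pow[OF this assms[OF that]] show ?thesis
      unfolding t_def coeff[OF that] torus_gen_eq .
  qed
  have "foldr (\<otimes>\<^bsub>Q\<^esub>) (map t xs) \<one>\<^bsub>Q\<^esub>
      = cls (Poly_Mapping.single (map Pos (filter (\<lambda>i. \<kappa> i = 1) xs)) 1)"
    if "set xs \<subseteq> {1..n}" for xs
    using that
  proof (induction xs)
    case Nil
    show ?case by (simp add: Q_sel(2) one_eq_single_Nil)
  next
    case (Cons x xs)
    let ?w = "map Pos (filter (\<lambda>i. \<kappa> i = 1) xs)"
    have C: "Poly_Mapping.single [Pos x] 1 \<in> C" "Poly_Mapping.single ?w 1 \<in> C"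
      using Cons.prems by (auto intro!: single_in_free_algebra simp: subset_eq)
    then have Q: "cls (Poly_Mapping.single ?w 1) \<in> carrier Q"
      unfolding Q_sel by blast
    show ?case
      using C Q Cons by (simp add: t Q_ops mult_single plus_list_def)
  qed
  moreover have "set [1..<Suc n] \<subseteq> {1..n}" by auto
  ultimately show ?thesis
    unfolding torus_monom_def quantum_torus_eq t_def by blast
qed

lemma cls_move_front:
  assumes "x \<in> {1..n}" and "set xs \<subseteq> {1..n}"
  shows "cls (Poly_Mapping.single (map Pos (xs @ [x])) 1)
    = cls (Poly_Mapping.single (map Pos (x # xs)) (\<Prod>y\<leftarrow>xs. q x y))"
  using assms(2)
proof (induction xs)
  case (Cons y xs)
  let ?s = "Poly_Mapping.single :: torus_letter list \<Rightarrow> 'f \<Rightarrow> _"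
  let ?c = "\<Prod>y\<leftarrow>xs. q x y"
  have C: "?s [Pos y] c \<in> C" "?s (map Pos xs) c \<in> C" "?s (map Pos (xs @ [x])) c \<in> C"
    "?s [Pos x, Pos y] c \<in> C" for c
    using Cons.prems assms(1) by (auto intro!: single_in_free_algebra simp: subset_eq)
  have "cls (?s [Pos y] 1 * ?s (map Pos (xs @ [x])) 1)
      = cls (?s [Pos y] 1 * ?s (map Pos (x # xs)) ?c)"
    using Cons C by (intro cls_mult_cong) auto
  also have "\<dots> = cls (?s [Pos y, Pos x] 1 * ?s (map Pos xs) ?c)"
    by (simp add: mult_single plus_list_def)
  also have "\<dots> = cls (?s [Pos x, Pos y] (q x y) * ?s (map Pos xs) ?c)"
    using Cons.prems assms(1) C by (intro cls_mult_cong cls_commute refl) auto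
  finally show ?case by (simp add: mult_single plus_list_def)
qed simp

text \<open>
  The last letter of the reversed word is \<open>x\<close>.  Once the rest has been sorted by induction,
  \<open>x\<close> is moved to the front past all other letters, which costs the factors \<open>q x y\<close>.
\<close>

lemma cls_reverse_word:
  assumes "set xs \<subseteq> {1..n}"
  shows "cls (reversal a (Poly_Mapping.single (map Pos xs) 1))
    = cls (Poly_Mapping.single (map Pos xs) (reversal_factor a q xs))"
  using assms
proof (induction xs)
  case (Cons x xs)
  let ?s = "Poly_Mapping.single :: torus_letter list \<Rightarrow> 'f \<Rightarrow> _"
  let ?c = "\<Prod>y\<leftarrow>xs. q x y"
  have C: "?s (map Pos xs) c \<in> C" "?s [Pos x] c \<in> C" "?s [] c \<in> C"
    "?s (map Pos (x # xs)) c \<in> C" for c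
    using Cons.prems by (auto intro!: single_in_free_algebra simp: subset_eq)
  have "cls (reversal a (?s (map Pos (x # xs)) 1))
      = cls (reversal a (?s (map Pos xs) 1) * ?s [Pos x] (a x))"
    by (simp add: reversal_single mult_single plus_list_def mult_ac)
  also have "\<dots> = cls (?s (map Pos xs) (reversal_factor a q xs) * ?s [Pos x] (a x))"
    using Cons C by (intro cls_mult_cong refl) auto
  also have "\<dots> = cls (?s [] (a x * reversal_factor a q xs) * ?s (map Pos (xs @ [x])) 1)"
    by (simp add: mult_single plus_list_def mult_ac)
  also have "\<dots> = cls (?s [] (a x * reversal_factor a q xs) * ?s (map Pos (x # xs)) ?c)"
    using Cons.prems C
    by (intro cls_mult_cong cls_move_front refl)
      (auto intro!: single_in_free_algebra simp: subset_eq)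
  finally show ?case by (simp add: mult_single plus_list_def mult_ac)
qed (simp add: reversal_single)

end


section \<open>Nonvanishing of monomials\<close>

text \<open>
  The matrix $\mathbf h_{l,n}$ with integer entries.  Counting requires signs in the integers, as
  sums of signs in a field of positive characteristic lose information.
\<close>

definition block_sign :: "nat \<Rightarrow> nat \<Rightarrow> nat \<Rightarrow> int" where
  "block_sign l i j =
    (if (even j \<and> j = Suc i \<and> j \<le> 2 * l) \<or> (even i \<and> i = Suc j \<and> i \<le> 2 * l) then -1 else 1)"

lemma h_mat_eq_block_sign:
  assumes "i \<ge> 1" "j \<ge> 1"
  shows "h_mat l i j = of_int (block_sign l i j)"
proof -
  have "(\<exists>k\<in>{1..l}. {i, j} = {2 * k - 1, 2 * k})
      \<longleftrightarrow> (even j \<and> j = Suc i \<and> j \<le> 2 * l) \<or> (even i \<and> i = Suc j \<and> i \<le> 2 * l)" (is "?A \<longleftrightarrow> ?B")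
  proof
    show ?B if ?A
    proof -
      from that obtain k where "k \<in> {1..l}" "{i, j} = {2 * k - 1, 2 * k}" by blast
      then show ?thesis by (auto simp: doubleton_eq_iff)
    qed
    show ?A if ?B
    proof -
      from that consider k where "j = 2 * k" "j = Suc i" "j \<le> 2 * l"
        | k where "i = 2 * k" "i = Suc j" "i \<le> 2 * l"
        by (auto elim: evenE)
      then show ?thesis
      proof cases
        case (1 k)
        then have "k \<in> {1..l}" "{i, j} = {2 * k - 1, 2 * k}" by auto
        then show ?thesis by blast
      next
        case (2 k)
        then have "k \<in> {1..l}" "{i, j} = {2 * k - 1, 2 * k}" by auto
        then show ?thesis by blast
      qed
    qed
  qed
  then show ?thesis
    unfolding h_mat_def block_sign_def
    by (simp only: if_distrib[of of_int] of_int_minus of_int_1)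
qed

text \<open>
  Operators on functions of bit sequences, one bit per block.  The bit of the block $\{2k-1,2k\}$
  has index $2k$; the letter $t_{2k}$ flips this bit, and $t_{2k-1}$ multiplies by $(-1)$ to
  the power of this bit.  These are two anticommuting involutions (the Pauli matrices $X$ and $Z$), and
  operators of different blocks commute.  Indices outside the blocks act trivially.
\<close>

definition clifford :: "nat \<Rightarrow> nat \<Rightarrow> ((nat \<Rightarrow> bool) \<Rightarrow> 'f::field) \<Rightarrow> (nat \<Rightarrow> bool) \<Rightarrow> 'f" where
  "clifford l i f X =
    (if i > 2 * l then f X
     else if even i then f (X(i := \<not> X i))
     else if X (Suc i) then - f X else f X)"

lemma clifford_clifford [simp]: "clifford l i (clifford l i f) = f"
  by (rule ext) (simp add: clifford_def)

lemma clifford_commute: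
  fixes f :: "(nat \<Rightarrow> bool) \<Rightarrow> 'f::field"
  assumes "i \<ge> 1" "j \<ge> 1"
  shows "clifford l j (clifford l i f) X = h_mat l i j * clifford l i (clifford l j f) X"
proof (cases "i = j")
  case True
  then have "h_mat l i j = (1 :: 'f)"
    unfolding h_mat_eq_block_sign[OF assms] by (simp add: block_sign_def)
  with True show ?thesis by simp
next
  case False
  then have "X(i := a, j := b) = X(j := b, i := a)" for a b by (rule fun_upd_twist)
  with False show ?thesis
    by (auto simp: h_mat_eq_block_sign[OF assms] block_sign_def clifford_def)
qed

definition word_action ::
    "nat \<Rightarrow> torus_letter list \<Rightarrow> ((nat \<Rightarrow> bool) \<Rightarrow> 'f::field) \<Rightarrow> (nat \<Rightarrow> bool) \<Rightarrow> 'f" where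
  "word_action l w f = foldr (\<lambda>x. clifford l (letter_index x)) w f"

lemma word_action_simps [simp]:
  "word_action l [] f = f"
  "word_action l (x # w) f = clifford l (letter_index x) (word_action l w f)"
  "word_action l (v @ w) f = word_action l v (word_action l w f)"
  by (simp_all add: word_action_def)

text \<open>
  Every letter acts by an involution, so the reversed word acts by the inverse operator.
\<close>

lemma word_action_rev: "word_action l w (word_action l (rev w) f) = f"
  by (induction w arbitrary: f) simp_all

lemma word_action_add:
  "word_action l w (\<lambda>X. f X + g X) = (\<lambda>X. word_action l w f X + word_action l w g X)"
  by (induction w) (auto simp: clifford_def fun_eq_iff)

lemma word_action_scale: "word_action l w (\<lambda>X. c * f X) = (\<lambda>X. c * word_action l w f X)"
  by (induction w) (auto simp: clifford_def fun_eq_iff)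

lemma word_action_zero: "word_action l w (\<lambda>X. 0) = (\<lambda>X. 0)"
  using word_action_scale[of l w 0] by simp

definition action ::
    "nat \<Rightarrow> (torus_letter, 'f::field) free_elem \<Rightarrow> ((nat \<Rightarrow> bool) \<Rightarrow> 'f) \<Rightarrow> (nat \<Rightarrow> bool) \<Rightarrow> 'f"
  where
  "action l p f X = lin_ext (\<lambda>w c. c * word_action l w f X) p"

lemma action_single: "action l (Poly_Mapping.single w c) f = (\<lambda>X. c * word_action l w f X)"
  by (simp add: action_def lin_ext_single fun_eq_iff)

lemma action_one: "action l 1 f = f"
  unfolding one_eq_single_Nil action_single by simp

lemma action_add: "action l (p + q) f = (\<lambda>X. action l p f X + action l q f X)"
  unfolding action_def fun_eq_iff by (intro allI lin_ext_add) (simp_all add: distrib_right)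

lemma action_zero: "action l p (\<lambda>X. 0) = (\<lambda>X. 0)"
  by (simp add: action_def lin_ext_def word_action_zero fun_eq_iff)

lemma action_mult: "action l (p * q) f = action l p (action l q f)"
proof -
  have all: "p \<in> carrier (free_algebra UNIV)" for p :: "(torus_letter, 'f::field) free_elem"
    by (simp add: free_algebra_sel)
  show ?thesis
    using all[of p]
  proof (induction p rule: free_algebra_induct)
    case (single w c)
    show ?case
      using all[of q]
      by (induction q rule: free_algebra_induct)
        (simp_all add: action_single mult_single plus_list_def mult_ac action_add
          distrib_left word_action_add word_action_scale)
  qed (simp add: action_add distrib_right)
qed

lemma symmetric_torus_h_mat: "symmetric_torus (h_mat l)"
  by unfold_locales (simp add: h_mat_def insert_commute)

text \<open>
  The elements of the free algebra that act as zero form an ideal containing the relations, hence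
  the torus acts.  A word acts invertibly, so no nonzero multiple of it is zero in the torus.
\<close>

lemma h_torus_word_eq_iff:
  fixes c d :: "'f::field"
  shows "presentation.cls (torus_letters n) (torus_rels n (h_mat l)) (Poly_Mapping.single w c)
    = presentation.cls (torus_letters n) (torus_rels n (h_mat l)) (Poly_Mapping.single w d)
    \<longleftrightarrow> c = d"
proof -
  interpret symmetric_torus n "h_mat l :: nat \<Rightarrow> nat \<Rightarrow> 'f" by (rule symmetric_torus_h_mat)
  let ?J = "{p \<in> C. \<forall>f. action l p f = (\<lambda>X. 0)}"
  have diff: "action l (p - r) f = (\<lambda>X. action l p f X - action l r f X)"
    for p r :: "(torus_letter, 'f) free_elem" and f
    using action_add[of l "p - r" r f] by (simp add: fun_eq_iff)
  have "action l r f = (\<lambda>X. 0)" if r: "r \<in> torus_rels n (h_mat l)"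
    for r :: "(torus_letter, 'f) free_elem" and f
  proof -
    consider i where "r = Poly_Mapping.single [Pos i, Neg i] 1 - 1"
      | i where "r = Poly_Mapping.single [Neg i, Pos i] 1 - 1"
      | i j where "i \<ge> 1" "j \<ge> 1"
          "r = Poly_Mapping.single [Pos j, Pos i] 1 - Poly_Mapping.single [Pos i, Pos j] (h_mat l i j)"
      using r unfolding torus_rels_eq by auto
    then show ?thesis
    proof cases
      case (3 i j)
      then show ?thesis
        by (simp add: diff action_single clifford_commute[of i j])
    qed (simp_all add: diff action_one action_single)
  qed
  then have "torus_rels n (h_mat l) \<subseteq> ?J"
    using torus_rels_in_free_algebra by blast
  moreover have "ideal ?J (free_algebra (torus_letters n))"
  proof (rule ideal_free_algebraI)
    show "0 \<in> ?J" by (simp add: action_def fun_eq_iff)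
  qed (auto simp: action_add action_mult action_zero add_in_free_algebra mult_in_free_algebra)
  ultimately have "relator_ideal \<subseteq> ?J" by (rule relator_ideal_minimal)
  have "c = d" if "Poly_Mapping.single w c - Poly_Mapping.single w d \<in> relator_ideal"
  proof -
    \<comment> \<open>evaluated at the preimage of the constant function \<open>1\<close> under the word, giving \<open>c - d\<close>\<close>
    have "action l (Poly_Mapping.single w (c - d)) (word_action l (rev w) (\<lambda>_. 1)) = (\<lambda>X. 0)"
      using subsetD[OF \<open>relator_ideal \<subseteq> ?J\<close> that] by (simp add: single_diff)
    then show ?thesis by (simp add: action_single word_action_rev fun_eq_iff)
  qed
  then show ?thesis using zero_ideal by (auto simp: cls_eq_iff)
qed


section \<open>Counting fixed monomials\<close>

definition sign_sum :: "(nat \<Rightarrow> int) \<Rightarrow> (nat \<Rightarrow> nat \<Rightarrow> int) \<Rightarrow> nat list \<Rightarrow> int" where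
  "sign_sum a q xs = (\<Sum>K\<in>Pow (set xs). reversal_factor a q (filter (\<lambda>i. i \<in> K) xs))"

lemma sum_Pow_insert:
  assumes "finite A" "x \<notin> A"
  shows "sum f (Pow (insert x A)) = (\<Sum>K\<in>Pow A. f K + f (insert x K))"
proof -
  have "inj_on (insert x) (Pow A)" using assms by (auto simp: inj_on_def)
  moreover have "Pow A \<inter> insert x ` Pow A = {}" using assms by auto
  ultimately show ?thesis
    using assms by (simp add: Pow_insert sum.union_disjoint sum.reindex sum.distrib)
qed

text \<open>
  A sublist \<open>ys\<close> of \<open>xs\<close> accounts for two sublists of \<open>x # xs\<close>: without \<open>x\<close>, and with \<open>x\<close> in
  front, where the factor is changed only by what \<open>x\<close> contributes.
\<close>

lemma sign_sum_Cons:
  assumes "x \<notin> set xs"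
  shows "sign_sum a q (x # xs) =
    (\<Sum>K\<in>Pow (set xs). let ys = filter (\<lambda>i. i \<in> K) xs
      in (1 + a x * (\<Prod>y\<leftarrow>ys. q x y)) * reversal_factor a q ys)"
proof -
  have *: "filter (\<lambda>i. i = x \<or> i \<in> K) xs = filter (\<lambda>i. i \<in> K) xs" for K
    using assms by (intro filter_cong) auto
  show ?thesis
    unfolding sign_sum_def list.set sum_Pow_insert[OF finite_set assms]
    by (rule sum.cong) (use assms in \<open>auto simp: * Let_def distrib_right\<close>)
qed

lemma prod_list_eq_1: "(\<And>y. y \<in> set ys \<Longrightarrow> f y = 1) \<Longrightarrow> (\<Prod>y\<leftarrow>ys. f y) = (1::int)"
  by (induction ys) auto

lemma sign_sum_central:
  assumes "x \<notin> set xs" and "\<And>y. y \<in> set xs \<Longrightarrow> q x y = 1"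
  shows "sign_sum a q (x # xs) = (1 + a x) * sign_sum a q xs"
proof -
  have "prod_list (map (q x) (filter P xs)) = 1" for P
    using assms(2) by (auto intro!: prod_list_eq_1)
  then show ?thesis
    unfolding sign_sum_Cons[OF assms(1)] by (simp add: sign_sum_def sum_distrib_left Let_def)
qed

text \<open>
  The four summands correspond to the subsets of \<open>{x, y}\<close>; the last one is negative because
  \<open>x\<close> and \<open>y\<close> anticommute.
\<close>

lemma sign_sum_block:
  assumes "x \<notin> set (y # xs)" and "y \<notin> set xs" and "q x y = -1"
    and "\<And>z. z \<in> set xs \<Longrightarrow> q x z = 1" and "\<And>z. z \<in> set xs \<Longrightarrow> q y z = 1"
  shows "sign_sum a q (x # y # xs) = (1 + a x + a y - a x * a y) * sign_sum a q xs"
proof -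
  have *: "filter (\<lambda>i. i = y \<or> i \<in> K) xs = filter (\<lambda>i. i \<in> K) xs" for K
    using assms by (intro filter_cong) auto
  have one: "prod_list (map (q x) (filter P xs)) = 1" "prod_list (map (q y) (filter P xs)) = 1" for P
    using assms(4,5) by (auto intro!: prod_list_eq_1)
  have yK: "y \<notin> K" if "K \<subseteq> set xs" for K using that assms by auto
  have "sign_sum a q (x # y # xs) = (\<Sum>K\<in>Pow (set xs).
      (1 + a x + a y - a x * a y) * reversal_factor a q (filter (\<lambda>i. i \<in> K) xs))"
    unfolding sign_sum_Cons[OF assms(1)] list.set sum_Pow_insert[OF finite_set assms(2)]
    by (rule sum.cong)
      (auto simp: * yK Let_def assms(3) one algebra_simps)
  then show ?thesis by (simp add: sign_sum_def sum_distrib_left)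
qed

lemma sign_sum_tail:
  assumes "m > 2 * l"
  shows "sign_sum a (block_sign l) [m..<Suc n] = (\<Prod>i=m..n. 1 + a i)"
proof (cases "m \<le> Suc n")
  case True
  then show ?thesis using assms
  proof (induction m rule: inc_induct)
    case base
    then show ?case by (simp add: sign_sum_def)
  next
    case (step m)
    have "sign_sum a (block_sign l) (m # [Suc m..<Suc n])
        = (1 + a m) * sign_sum a (block_sign l) [Suc m..<Suc n]"
      using step by (intro sign_sum_central) (auto simp: block_sign_def)
    moreover have "[m..<Suc n] = m # [Suc m..<Suc n]"
      using step by (intro upt_conv_Cons) simp
    ultimately show ?case
      using step by (simp add: prod.atLeast_Suc_atMost del: upt_Suc)
  qed
qed (simp add: sign_sum_def)

text \<open>
  Each block commutes with all later indices and so splits off by \<open>sign_sum_block\<close>; the indices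
  beyond \<open>2 * l\<close> commute with everything and split off one by one.
\<close>

lemma sign_sum_blocks:
  assumes "2 * l \<le> n"
  shows "sign_sum a (block_sign l) [1..<Suc n] =
    (\<Prod>k<l. 1 + a (2 * k + 1) + a (2 * k + 2) - a (2 * k + 1) * a (2 * k + 2))
      * (\<Prod>i=2 * l + 1..n. 1 + a i)"
proof -
  let ?g = "\<lambda>k. 1 + a (2 * k + 1) + a (2 * k + 2) - a (2 * k + 1) * a (2 * k + 2)"
  have "sign_sum a (block_sign l) [2 * m + 1..<Suc n] =
      (\<Prod>k=m..<l. ?g k) * (\<Prod>i=2 * l + 1..n. 1 + a i)" if "m \<le> l" for m
    using that
  proof (induction m rule: inc_induct)
    case base
    show ?case by (simp add: sign_sum_tail del: upt_Suc)
  next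
    case (step m)
    have "[2 * m + 1..<Suc n] = (2 * m + 1) # (2 * m + 2) # [2 * Suc m + 1..<Suc n]"
      using step assms by (simp add: upt_conv_Cons del: upt_Suc)
    moreover have "sign_sum a (block_sign l) ((2 * m + 1) # (2 * m + 2) # [2 * Suc m + 1..<Suc n])
        = ?g m * sign_sum a (block_sign l) [2 * Suc m + 1..<Suc n]"
      using step by (intro sign_sum_block) (auto simp: block_sign_def)
    ultimately show ?case
      using step by (simp add: prod.atLeast_Suc_lessThan mult.assoc del: upt_Suc)
  qed
  from this[of 0] show ?thesis by (simp add: atLeast0LessThan del: upt_Suc)
qed

lemma reversal_factor_unit:
  assumes "\<And>i. a i \<in> {1, -1}" "\<And>i j. q i j \<in> {1, -1}"
  shows "reversal_factor a q xs \<in> {1, -1 :: int}"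
proof (induction xs)
  case (Cons x xs)
  have "(\<Prod>y\<leftarrow>xs. q x y) \<in> {1, -1}"
  proof (induction xs)
    case (Cons y xs)
    then show ?case using assms(2)[of x y] by auto
  qed simp
  with Cons assms(1)[of x] show ?case by auto
qed simp

text \<open>
  For a sign $\varepsilon$ the number $1+\varepsilon$ is $2$ or $0$, so summing it counts the
  positive signs twice.
\<close>

lemma card_positive_subsets:
  assumes "\<And>i. a i \<in> {1, -1}" "\<And>i j. q i j \<in> {1, -1}"
  shows "2 * int (card {K \<in> Pow (set xs). reversal_factor a q (filter (\<lambda>i. i \<in> K) xs) = 1})
    = 2 ^ card (set xs) + sign_sum a q xs"
proof -
  let ?r = "\<lambda>K. reversal_factor a q (filter (\<lambda>i. i \<in> K) xs)"
  have "2 * int (card {K \<in> Pow (set xs). ?r K = 1}) = (\<Sum>K\<in>Pow (set xs). if ?r K = 1 then 2 else 0)"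
    by (simp add: sum.If_cases Int_def)
  also have "\<dots> = (\<Sum>K\<in>Pow (set xs). 1 + ?r K)"
    using reversal_factor_unit[OF assms] by (intro sum.cong) force+
  finally show ?thesis by (simp add: sum.distrib sign_sum_def card_Pow)
qed

lemma of_int_reversal_factor:
  "(of_int (reversal_factor a q xs) :: 'a::comm_ring_1)
    = reversal_factor (\<lambda>i. of_int (a i)) (\<lambda>i j. of_int (q i j)) xs"
proof (induction xs)
  case (Cons x xs)
  have "(of_int (\<Prod>y\<leftarrow>xs. q x y) :: 'a) = (\<Prod>y\<leftarrow>xs. of_int (q x y))"
    by (induction xs) auto
  with Cons show ?case by simp
qed simp

lemma reversal_factor_cong:
  assumes "\<And>i j. i \<in> set xs \<Longrightarrow> j \<in> set xs \<Longrightarrow> q i j = q' i j"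
  shows "reversal_factor a q xs = reversal_factor a q' xs"
  using assms
proof (induction xs)
  case (Cons x xs)
  then have "map (q x) xs = map (q' x) xs" by simp
  moreover have "reversal_factor a q xs = reversal_factor a q' xs" using Cons by simp
  ultimately show ?case by (simp only: reversal_factor.simps)
qed simp

lemma reversal_factor_h_mat:
  assumes "set xs \<subseteq> {1..n}"
  shows "reversal_factor (\<lambda>i. of_int (a i)) (h_mat l) xs
    = (of_int (reversal_factor a (block_sign l) xs) :: 'f::field)"
  unfolding of_int_reversal_factor
  by (rule reversal_factor_cong) (use assms in \<open>auto simp: h_mat_eq_block_sign subset_eq\<close>)

lemma bij_betw_support:
  "bij_betw (\<lambda>\<kappa>. {i \<in> A. \<kappa> i = 1}) (A \<rightarrow>\<^sub>E {0, 1 :: int}) (Pow A)"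
proof (rule bij_betw_byWitness[where f' = "\<lambda>K. \<lambda>i\<in>A. if i \<in> K then 1 else 0"])
  show "\<forall>\<kappa>\<in>A \<rightarrow>\<^sub>E {0, 1 :: int}. (\<lambda>i\<in>A. if i \<in> {i \<in> A. \<kappa> i = 1} then 1 else 0) = \<kappa>"
    by (auto simp: fun_eq_iff PiE_iff extensional_def)
qed (auto simp: PiE_iff split: if_splits)

text \<open>
  An exponent vector \<open>\<kappa>\<close> corresponds to its support.  The involution multiplies its monomial by a
  sign; as a monomial differs from its negative when $-1\ne1$ in the field, the monomial is fixed
  exactly when the sign is $1$ already in the integers.
\<close>

lemma card_I_set:
  assumes char: "CHAR('f::field) \<noteq> 2" and a: "\<And>i. a i \<in> {1, -1 :: int}"
    and \<tau>: "\<tau> = (torus_involution n (h_mat l) (\<lambda>i. of_int (a i)) :: 'f torus_elem \<Rightarrow> _)"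
  shows "2 * int (card (I_set n (S_set n l \<tau>)))
    = 2 ^ n + sign_sum a (block_sign l) [1..<Suc n]"
proof -
  let ?h = "h_mat l :: nat \<Rightarrow> nat \<Rightarrow> 'f"
  interpret symmetric_torus n ?h by (rule symmetric_torus_h_mat)
  have two: "(2 :: 'f) \<noteq> 0"
  proof
    assume "(2 :: 'f) = 0"
    then have "CHAR('f) dvd 2"
      using of_nat_eq_0_iff_char_dvd[of 2, where 'a = 'f] by simp
    then have "CHAR('f) \<le> 2" "CHAR('f) \<noteq> 0"
      by (simp_all add: dvd_imp_le) (metis dvd_0_left zero_neq_numeral gr0I)
    moreover have "CHAR('f) \<noteq> Suc 0" by simp
    ultimately show False using char by linarith
  qed
  have pm: "of_int c = (1 :: 'f) \<longleftrightarrow> c = 1" if "c \<in> {1, -1}" for c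
  proof -
    have "(- 1 :: 'f) \<noteq> 1" using two by (metis one_add_one add.right_inverse)
    then show ?thesis using that by auto
  qed
  have bs: "block_sign l i j \<in> {1, -1}" for i j by (simp add: block_sign_def)
  let ?K = "\<lambda>\<kappa>. {i \<in> {1..n}. \<kappa> i = (1 :: int)}"
  let ?P = "\<lambda>K. reversal_factor a (block_sign l) (filter (\<lambda>i. i \<in> K) [1..<Suc n]) = 1"
  have "(\<Sum>i = 1..n. frag_cmul (\<kappa> i) (frag_of i)) \<in> S_set n l \<tau> \<longleftrightarrow> ?P (?K \<kappa>)"
    if \<kappa>: "\<kappa> \<in> {1..n} \<rightarrow>\<^sub>E {0, 1}" for \<kappa>
  proof -
    let ?\<alpha> = "\<Sum>i = 1..n. frag_cmul (\<kappa> i) (frag_of i)"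
    define xs where "xs = filter (\<lambda>i. \<kappa> i = 1) [1..<Suc n]"
    have xs: "xs = filter (\<lambda>i. i \<in> ?K \<kappa>) [1..<Suc n]" "set xs \<subseteq> {1..n}"
      unfolding xs_def by (auto intro: filter_cong)
    have monom: "torus_monom n ?h ?\<alpha> = cls (Poly_Mapping.single (map Pos xs) 1)"
      unfolding xs_def using \<kappa> by (intro torus_monom_squarefree) auto
    have "?\<alpha> \<in> carrier (free_Abelian_group {1..n})"
      using keys_sum[of "\<lambda>i. frag_cmul (\<kappa> i) (frag_of i)" "{1..n}"]
      by (auto simp: free_Abelian_group_def)
    moreover have "\<tau> (torus_monom n ?h ?\<alpha>)
        = cls (Poly_Mapping.single (map Pos xs) (of_int (reversal_factor a (block_sign l) xs)))"
    proof -
      have "of_int (a i) * of_int (a i) = (1 :: 'f)" for i using a[of i] by auto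
      then have "\<tau> (torus_monom n ?h ?\<alpha>)
          = cls (reversal (\<lambda>i. of_int (a i)) (Poly_Mapping.single (map Pos xs) 1))"
        unfolding monom \<tau>
        using xs(2) by (intro torus_involution_cls single_in_free_algebra) (auto simp: subset_eq)
      then show ?thesis
        by (simp only: cls_reverse_word[OF xs(2)] reversal_factor_h_mat[OF xs(2)])
    qed
    ultimately have "?\<alpha> \<in> S_set n l \<tau> \<longleftrightarrow>
        cls (Poly_Mapping.single (map Pos xs) (of_int (reversal_factor a (block_sign l) xs)))
          = cls (Poly_Mapping.single (map Pos xs) 1)"
      by (simp only: S_set_def mem_Collect_eq monom simp_thms)
    then have "?\<alpha> \<in> S_set n l \<tau> \<longleftrightarrow> reversal_factor a (block_sign l) xs = 1"
      by (simp only: h_torus_word_eq_iff pm[OF reversal_factor_unit[where xs = xs, OF a bs]])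
    then show ?thesis
      by (simp only: xs(1)[symmetric])
  qed
  then have I_set: "I_set n (S_set n l \<tau>) = {\<kappa> \<in> {1..n} \<rightarrow>\<^sub>E {0, 1}. ?P (?K \<kappa>)}"
    unfolding I_set_def by (intro Collect_cong conj_cong refl)
  have card: "card (I_set n (S_set n l \<tau>)) = card {K \<in> Pow {1..n}. ?P K}"
    unfolding I_set
  proof (rule bij_betw_same_card[where f = ?K])
    show "bij_betw ?K {\<kappa> \<in> {1..n} \<rightarrow>\<^sub>E {0, 1}. ?P (?K \<kappa>)} {K \<in> Pow {1..n}. ?P K}"
      using bij_betw_support[of "{1..n}"]
      by (rule bij_betw_Collect) simp
  qed
  have "set [1..<Suc n] = {1..n}" by auto
  moreover have "card {1..n} = n" by simp
  ultimately show ?thesis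
    using card_positive_subsets[where xs = "[1..<Suc n]", OF a bs] by (simp only: card)
qed

lemma card_inv_star:
  assumes "CHAR('f::field) \<noteq> 2" and "n \<ge> 1" and l: "2 * l \<le> n"
  shows "card (I_set n (S_set n l (inv_star n l :: 'f torus_elem \<Rightarrow> _))) = 2 ^ (n - 1) + 2 ^ (n - l - 1)"
proof -
  have "2 * int (card (I_set n (S_set n l (inv_star n l :: 'f torus_elem \<Rightarrow> _))))
      = 2 ^ n + sign_sum (\<lambda>_. 1) (block_sign l) [1..<Suc n]"
    by (rule card_I_set[OF assms(1)]) (simp_all add: inv_star_def)
  also have "sign_sum (\<lambda>_. 1) (block_sign l) [1..<Suc n] = 2 ^ (l + (n - 2 * l))"
    unfolding sign_sum_blocks[OF l] by (simp add: power_add)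
  \<comment> \<open>\<open>n - l\<close>, in a form from which the factor \<open>2\<close> can be cancelled\<close>
  also have "l + (n - 2 * l) = Suc (n - l - 1)" using l \<open>n \<ge> 1\<close> by simp
  also have "(2::int) ^ n = 2 * 2 ^ (n - 1)" using \<open>n \<ge> 1\<close> by (simp flip: power_Suc)
  finally have "int (card (I_set n (S_set n l (inv_star n l :: 'f torus_elem \<Rightarrow> _))))
      = int (2 ^ (n - 1) + 2 ^ (n - l - 1))" by simp
  then show ?thesis by (simp only: of_nat_eq_iff)
qed

text \<open>
  The sum of signs vanishes because of the factor $1+a_{2l+1}=0$.
\<close>

lemma card_inv_tau1:
  assumes "CHAR('f::field) \<noteq> 2" and l: "n > 2 * l"
  shows "card (I_set n (S_set n l (inv_tau1 n l :: 'f torus_elem \<Rightarrow> _))) = 2 ^ (n - 1)"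
proof -
  let ?a = "\<lambda>i. if i = 2 * l + 1 then - 1 else (1 :: int)"
  have "2 * int (card (I_set n (S_set n l (inv_tau1 n l :: 'f torus_elem \<Rightarrow> _))))
      = 2 ^ n + sign_sum ?a (block_sign l) [1..<Suc n]"
    by (rule card_I_set[OF assms(1)])
      (auto simp: inv_tau1_def intro!: arg_cong[of _ _ "torus_involution n (h_mat l)"])
  also have "sign_sum ?a (block_sign l) [1..<Suc n] = 0"
    using l by (subst sign_sum_blocks) (auto intro!: bexI[of _ "2 * l + 1"])
  also have "(2::int) ^ n = 2 * 2 ^ (n - 1)" using l by (simp flip: power_Suc)
  finally have "int (card (I_set n (S_set n l (inv_tau1 n l :: 'f torus_elem \<Rightarrow> _))))
      = int (2 ^ (n - 1))" by simp
  then show ?thesis by (simp only: of_nat_eq_iff)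
qed

text \<open>
  The last block is the exceptional one: its factor is $1-1-1-1=-2$, and all others are $2$.
\<close>

lemma card_inv_tau2:
  assumes "CHAR('f::field) \<noteq> 2" and "1 \<le> l" and l: "2 * l \<le> n"
  shows "int (card (I_set n (S_set n l (inv_tau2 n l :: 'f torus_elem \<Rightarrow> _))))
    = 2 ^ (n - 1) - 2 ^ (n - l - 1)"
proof -
  let ?a = "\<lambda>i. if i = 2 * l - 1 \<or> i = 2 * l then - 1 else (1 :: int)"
  obtain m where m: "l = Suc m" using \<open>1 \<le> l\<close> by (cases l) auto
  have "2 * int (card (I_set n (S_set n l (inv_tau2 n l :: 'f torus_elem \<Rightarrow> _))))
      = 2 ^ n + sign_sum ?a (block_sign l) [1..<Suc n]"
    by (rule card_I_set[OF assms(1)])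
      (auto simp: inv_tau2_def intro!: arg_cong[of _ _ "torus_involution n (h_mat l)"])
  also have "sign_sum ?a (block_sign l) [1..<Suc n] = - (2 ^ (l + (n - 2 * l)))"
  proof -
    have "(\<Prod>k<m. 1 + ?a (2 * k + 1) + ?a (2 * k + 2) - ?a (2 * k + 1) * ?a (2 * k + 2)) = (\<Prod>k<m. 2)"
      by (rule prod.cong) (auto simp: m)
    moreover have "(\<Prod>i=2 * l + 1..n. 1 + ?a i) = (\<Prod>i=2 * l + 1..n. 2)"
      by (rule prod.cong) auto
    ultimately show ?thesis
      unfolding sign_sum_blocks[OF l] by (simp add: m power_add)
  qed
  \<comment> \<open>\<open>n - l\<close>, in a form from which the factor \<open>2\<close> can be cancelled\<close>
  also have "l + (n - 2 * l) = Suc (n - l - 1)" using l \<open>1 \<le> l\<close> by simp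
  also have "(2::int) ^ n = 2 * 2 ^ (n - 1)" using l \<open>1 \<le> l\<close> by (simp flip: power_Suc)
  finally show ?thesis by simp
qed

theorem lemma4p1:
  fixes n :: nat
  assumes char: "CHAR('f::field) \<noteq> 2"
    and n: "n \<ge> 1"
  shows
    "(\<forall>l. 2 * l \<le> n \<longrightarrow>
        card (I_set n (S_set n l (inv_star n l :: 'f torus_elem \<Rightarrow> _)))
          = 2 ^ (n - 1) + 2 ^ (n - l - 1))
   \<and> (\<forall>l. n > 2 * l \<longrightarrow>
        card (I_set n (S_set n l (inv_tau1 n l :: 'f torus_elem \<Rightarrow> _)))
          = 2 ^ (n - 1))
   \<and> (\<forall>l. 1 \<le> l \<and> 2 * l \<le> n \<longrightarrow>
        int (card (I_set n (S_set n l (inv_tau2 n l :: 'f torus_elem \<Rightarrow> _))))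
          = 2 ^ (n - 1) - 2 ^ (n - l - 1))
   \<and> (\<forall>l0 l1 l2. n \<ge> 2 * l0 \<and> n > 2 * l1 \<and> l2 \<ge> 1 \<and> n \<ge> 2 * l2 \<longrightarrow>
        card (I_set n (S_set n l0 (inv_star n l0 :: 'f torus_elem \<Rightarrow> _)))
          > card (I_set n (S_set n l1 (inv_tau1 n l1 :: 'f torus_elem \<Rightarrow> _)))
      \<and> card (I_set n (S_set n l1 (inv_tau1 n l1 :: 'f torus_elem \<Rightarrow> _)))
          > card (I_set n (S_set n l2 (inv_tau2 n l2 :: 'f torus_elem \<Rightarrow> _))))"
proof (intro conjI allI impI; (elim conjE)?)
  fix l0 l1 l2
  assume l: "n \<ge> 2 * l0" "n > 2 * l1" "l2 \<ge> 1" "n \<ge> 2 * l2"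
  note card_l1 = card_inv_tau1[OF char l(2)]
  show "card (I_set n (S_set n l0 (inv_star n l0 :: 'f torus_elem \<Rightarrow> _)))
      > card (I_set n (S_set n l1 (inv_tau1 n l1 :: 'f torus_elem \<Rightarrow> _)))"
    unfolding card_inv_star[OF char n l(1)] card_l1 by simp
  have "int (card (I_set n (S_set n l2 (inv_tau2 n l2 :: 'f torus_elem \<Rightarrow> _)))) < int (2 ^ (n - 1))"
    unfolding card_inv_tau2[OF char l(3,4)] by simp
  then show "card (I_set n (S_set n l1 (inv_tau1 n l1 :: 'f torus_elem \<Rightarrow> _)))
      > card (I_set n (S_set n l2 (inv_tau2 n l2 :: 'f torus_elem \<Rightarrow> _)))"
    unfolding card_l1 by (simp only: of_nat_less_iff)
qed (rule card_inv_star[OF char n] card_inv_tau1[OF char] card_inv_tau2[OF char]; assumption)+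

end
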